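(* For an integer $c>1$, the number of positive integers $n$ satisfying $\psi(n)=c$, where $\psi(n)=n-\varphi(n)$, equals $$G(c+1)+O\left(c^{0.75+o(1)}\right)$$ as $c\to\infty$.
   Context: $\varphi$ denotes Euler's totient function, $\varphi(n)=n\prod_{p\mid n}(1-1/p)$, and $\psi(n)=n-\varphi(n)$ is the cototient. For a positive integer $k$, $G(k)$ denotes the number of ways to represent $k$ as a sum of two primes. *)

theory Defs
  imports "HOL-Number_Theory.Number_Theory" "HOL-Library.Landau_Symbols"
begin

definition cototient :: "nat \<Rightarrow> nat" where
  "cototient n = n - totient n"

(* Unordered representations, each listed once with the smaller prime first: an integer
   p * q with p < q prime is a single solution of cototient n = p + q - 1. *)
definition G :: "nat \<Rightarrow> nat" where
  "G k = card {(p, q). prime p \<and> prime q \<and> p \<le> q \<and> p + q = k}"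

(* Hence the cardinality counted in the theorem is a genuine one for c > 1; for c = 1 the
   solutions are exactly the primes. *)
lemma finite_cototient_eq:
  assumes "c > 1"
  shows "finite {n. n > 0 \<and> cototient n = c}"
proof (rule finite_subset)
  show "{n. n > 0 \<and> cototient n = c} \<subseteq> {..c * c}"
  proof
    fix n assume "n \<in> {n. n > 0 \<and> cototient n = c}"
    then have n: "n > 0" "n - totient n = c" by (auto simp: cototient_def)
    have "n > 1" using n assms by (cases "n = 1") auto
    have "\<not> prime n"
    proof
      assume "prime n"
      then have "totient n = n - 1" by (rule totient_prime)
      then show False using n assms by simp
    qed
    then obtain d where d: "d dvd n" "d \<noteq> 1" "d \<noteq> n"
      using \<open>n > 1\<close> by (auto simp: prime_nat_iff)
    obtain e where e: "n = d * e" using d by blast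
    have bound: "y \<le> c" if "n = x * y" "x > 1" for x y
    proof -
      let ?M = "(\<lambda>k. x * k) ` {1..y}"
      have "totatives n \<subseteq> {1..n} - ?M"
        using that by (auto simp: totatives_def)
      then have "totient n \<le> card ({1..n} - ?M)"
        unfolding totient_def by (intro card_mono) auto
      also have "\<dots> = n - card ?M"
        using that by (subst card_Diff_subset) auto
      also have "card ?M = y"
        using that by (subst card_image) (auto simp: inj_on_def)
      finally have "totient n \<le> n - y" .
      moreover have "y \<le> n" using that by simp
      ultimately show "y \<le> c" using n by linarith
    qed
    have "d > 1" "e > 1" using d e n by (cases "e = 0"; cases "e = 1"; cases d; auto)+
    then have "e \<le> c" "d \<le> c" using bound[of d e] bound[of e d] e by (auto simp: mult.commute)
    then show "n \<in> {..c * c}" using e by (simp add: mult_le_mono)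
  qed
qed simp

end

theory Submission imports Defs begin

text \<open>
  A product of two distinct primes \<open>p q\<close> has cototient \<open>p + q - 1\<close>, which accounts for the main term up
  to the squares of primes. Any other solution is \<open>n = m q p\<close> with \<open>q \<le> p\<close> its two largest primes and
  \<open>m > 1\<close>. Write \<open>\<psi>\<close> for the cototient and \<open>\<phi>\<close> for the totient.

  If \<open>m \<le> c\<^sup>3\<^sup>/\<^sup>4\<close>, then \<open>m\<close> leaves only \<open>c\<^sup>o\<^sup>(\<^sup>1\<^sup>)\<close> choices for \<open>n\<close>: either \<open>n\<close> is divisible by
  \<open>q\<^sup>2\<close>, so that \<open>q\<close> divides \<open>c\<close> and \<open>m q\<close> determines \<open>p\<close> up to two choices, or
  \<open>(\<psi>(m) q + \<phi>(m)) (\<psi>(m) p + \<phi>(m)) = \<psi>(m) c + \<phi>(m) m\<close> and the divisor bound applies.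

  If \<open>m > c\<^sup>3\<^sup>/\<^sup>4\<close>, then \<open>m q \<le> c\<close> forces \<open>q < c\<^sup>1\<^sup>/\<^sup>4\<close>. Hence \<open>n \<le> c q \<le> c\<^sup>5\<^sup>/\<^sup>4\<close>, and \<open>m\<close>, having only
  small primes, has a divisor \<open>d\<close> between \<open>c\<^sup>1\<^sup>/\<^sup>2\<close> and \<open>c\<^sup>3\<^sup>/\<^sup>4\<close>. As \<open>d\<close> divides \<open>n\<close> and \<open>\<phi>(d)\<close> divides
  \<open>\<phi>(n) = n - c\<close>, the number \<open>n\<close> lies in a single residue class modulo \<open>lcm(d, \<phi>(d))\<close>, which is
  nonempty only if \<open>gcd(d, \<phi>(d))\<close> divides \<open>c\<close>; summing over \<open>d\<close> again gives \<open>c\<close> to the power \<open>3/4 + o(1)\<close>.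
\<close>

section \<open>Divisor bound\<close>

abbreviation tau :: "nat \<Rightarrow> nat" where
  "tau n \<equiv> card {d. d dvd n}"

lemma tau_mult_le:
  assumes "a > 0" "b > 0"
  shows "tau (a * b) \<le> tau a * tau b"
proof -
  have "{d. d dvd a * b} \<subseteq> (\<lambda>(x, y). x * y) ` ({d. d dvd a} \<times> {d. d dvd b})"
    using division_decomp[of _ a b] by fastforce
  then have "tau (a * b) \<le> card ({d. d dvd a} \<times> {d. d dvd b})"
    using assms by (intro surj_card_le) auto
  then show ?thesis
    by (simp add: card_cartesian_product)
qed

lemma tau_prime_power_le:
  assumes "prime p"
  shows "tau (p ^ a) \<le> a + 1"
proof -
  have "{d. d dvd p ^ a} \<subseteq> (\<lambda>i. p ^ i) ` {..a}"
    using divides_primepow_nat[OF assms] by auto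
  then show ?thesis
    using surj_card_le[of "{..a}"] by fastforce
qed

text \<open>The price of one small prime in the divisor bound: a prime \<open>p\<close> is at least
  2, so \<open>tau (p ^ a)\<close> is at most \<open>K * real (p ^ a) powr \<delta>\<close>.\<close>

lemma Suc_le_mult_powr:
  assumes "\<delta> > 0"
  obtains K :: real where "K \<ge> 1" "\<And>a::nat. real (a + 1) \<le> K * 2 powr (real a * \<delta>)"
proof
  define t where "t = \<delta> * ln 2"
  have t: "t > 0" using assms by (simp add: t_def)
  show "1 + 1 / t \<ge> 1" using t by simp
  fix a :: nat
  have "real (a + 1) \<le> (1 + 1 / t) * (1 + real a * t)"
    using t by (simp add: field_simps)
  also have "1 + real a * t \<le> exp (real a * t)"
    by (rule exp_ge_add_one_self)
  also have "exp (real a * t) = 2 powr (real a * \<delta>)"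
    by (simp add: powr_def t_def mult_ac)
  finally show "real (a + 1) \<le> (1 + 1 / t) * 2 powr (real a * \<delta>)"
    using t by (simp add: mult_left_mono)
qed

text \<open>Multiplying by a prime \<open>p\<close> at most doubles the number of divisors, while
  \<open>n powr \<delta>\<close> grows by the factor \<open>p powr \<delta>\<close>, which is at
  least 2.\<close>

lemma tau_le_powr_of_large_primes:
  fixes n :: nat
  assumes "n > 0" "\<And>p. prime p \<Longrightarrow> p dvd n \<Longrightarrow> 2 \<le> real p powr \<delta>"
  shows "real (tau n) \<le> real n powr \<delta>"
  using assms
proof (induction n rule: prime_divisors_induct)
  case (unit n)
  then show ?case by simp
next
  case (factor p n)
  have "n > 0" "p > 0" using factor by auto
  have "tau p \<le> 2"
    using tau_prime_power_le[OF factor(1), of 1] by simp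
  then have "tau (p * n) \<le> 2 * tau n"
    using tau_mult_le[OF \<open>p > 0\<close> \<open>n > 0\<close>] by (meson le_trans mult_le_mono1)
  then have "real (tau (p * n)) \<le> 2 * real (tau n)"
    by (metis of_nat_le_iff of_nat_mult of_nat_numeral)
  also have "\<dots> \<le> real p powr \<delta> * real n powr \<delta>"
    using factor \<open>n > 0\<close> by (intro mult_mono) auto
  finally show ?case by (simp add: powr_mult)
qed auto

text \<open>
  Only the primes \<open>p < B\<close> with \<open>p powr \<delta> < 2\<close> can cost a constant factor. The exponent \<open>j\<close> in \<open>bound\<close>
  counts how many of the numbers below \<open>B\<close> are still allowed as prime factors.
\<close>
lemma tau_le_mult_powr:
  assumes "\<delta> > 0"
  obtains C :: real where "C \<ge> 1" "\<And>n. n > 0 \<Longrightarrow> real (tau n) \<le> C * real n powr \<delta>"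
proof -
  obtain K :: real where K: "K \<ge> 1" "\<And>a::nat. real (a + 1) \<le> K * 2 powr (real a * \<delta>)"
    using Suc_le_mult_powr[OF assms] by blast
  define B where "B = nat \<lceil>2 powr (1 / \<delta>)\<rceil>"
  have large: "2 \<le> real p powr \<delta>" if "p \<ge> B" for p
  proof -
    have "2 powr (1 / \<delta>) \<le> real p" using that by (simp add: B_def)
    then have "(2 powr (1 / \<delta>)) powr \<delta> \<le> real p powr \<delta>"
      using assms by (intro powr_mono2) auto
    then show ?thesis using assms by (simp add: powr_powr)
  qed
  have bound: "real (tau n) \<le> K ^ j * real n powr \<delta>"
    if "n > 0" "\<And>p. prime p \<Longrightarrow> p dvd n \<Longrightarrow> p \<ge> B - j" for n j
    using that
  proof (induction j arbitrary: n)
    case 0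
    then show ?case
      using tau_le_powr_of_large_primes[of n \<delta>] large by simp
  next
    case (Suc j)
    define p where "p = B - Suc j"
    show ?case
    proof (cases "prime p")
      case False
      have "B - j \<le> q" if "prime q" "q dvd n" for q
        using Suc.prems(2)[OF that] False that by (cases "q = p") (auto simp: p_def)
      then have "real (tau n) \<le> K ^ j * real n powr \<delta>"
        using Suc.IH Suc.prems by blast
      also have "\<dots> \<le> K ^ Suc j * real n powr \<delta>"
        using K by (intro mult_right_mono power_increasing) auto
      finally show ?thesis .
    next
      case True
      obtain m where m: "n = p ^ multiplicity p n * m" "\<not> p dvd m"
        using multiplicity_decompose'[of n p] not_prime_unit[of p] True Suc.prems(1) by blast
      define a where "a = multiplicity p n"
      have n: "n = p ^ a * m" using m by (simp add: a_def)
      have "m > 0" "p > 0" using m Suc.prems True by (auto intro: Nat.gr0I)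
      have "B - j \<le> q" if "prime q" "q dvd m" for q
      proof -
        have "p \<le> q" using Suc.prems(2)[of q] that n by (simp add: p_def)
        moreover have "q \<noteq> p" using that m by auto
        ultimately show ?thesis by (auto simp: p_def)
      qed
      then have IH: "real (tau m) \<le> K ^ j * real m powr \<delta>"
        using Suc.IH[OF \<open>m > 0\<close>] by blast
      have "2 powr (real a * \<delta>) \<le> real p powr (real a * \<delta>)"
        using prime_ge_2_nat[OF True] assms by (intro powr_mono2) auto
      then have a: "real (a + 1) \<le> K * real p powr (real a * \<delta>)"
        using K by (meson mult_left_mono order_trans zero_le_one)
      have "tau n \<le> (a + 1) * tau m"
        using tau_mult_le[of "p ^ a" m] tau_prime_power_le[OF True, of a] \<open>m > 0\<close> \<open>p > 0\<close>
        unfolding n by (meson le_trans mult_le_mono1 zero_less_power)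
      then have "real (tau n) \<le> real (a + 1) * real (tau m)"
        by (metis of_nat_le_iff of_nat_mult)
      also have "\<dots> \<le> (K * real p powr (real a * \<delta>)) * (K ^ j * real m powr \<delta>)"
        using a IH K by (intro mult_mono) auto
      also have "real p powr (real a * \<delta>) = real (p ^ a) powr \<delta>"
        using \<open>p > 0\<close> by (simp add: powr_powr flip: powr_realpow)
      also have "K * real (p ^ a) powr \<delta> * (K ^ j * real m powr \<delta>) = K ^ Suc j * real n powr \<delta>"
        by (simp add: n powr_mult)
      finally show ?thesis .
    qed
  qed
  show thesis
  proof (rule that)
    show "K ^ B \<ge> 1" using K by simp
    \<comment> \<open>After \<open>B\<close> steps the lower bound on the primes is 0 and excludes
      nothing.\<close>
    show "real (tau n) \<le> K ^ B * real n powr \<delta>" if "n > 0" for n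
      using bound[OF that, of B] by simp
  qed
qed

text \<open>The totients of the divisors of \<open>n\<close> sum to \<open>n\<close>, and none of
  them exceeds \<open>totient n\<close>. Together with the divisor bound this keeps
  \<open>totient n\<close> almost as large as \<open>n\<close>.\<close>

lemma le_tau_mult_totient: "n > 0 \<Longrightarrow> n \<le> tau n * totient n"
proof -
  assume "n > 0"
  have "totient d \<le> totient n" if "d dvd n" for d
    using totient_dvd_mono[OF that] \<open>n > 0\<close> .
  then show ?thesis
    using sum_bounded_above[of "{d. d dvd n}" totient "totient n"] totient_divisor_sum[of n] by simp
qed

section \<open>Harmonic sums, counting in residue classes, divisors of prescribed size\<close>

lemma sum_inverse_le_ln: "n > 0 \<Longrightarrow> (\<Sum>k=1..n. 1 / real k) \<le> 1 + ln (real n)"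
proof (induction n rule: nat_induct_non_zero)
  case (Suc n)
  have "ln (real n / real (Suc n)) \<le> real n / real (Suc n) - 1"
    using Suc by (intro ln_le_minus_one) auto
  also have "\<dots> = - (1 / real (Suc n))" by (simp add: field_simps)
  finally show ?case using Suc by (simp add: ln_div)
qed simp

lemma real_card_positive_le:
  assumes "x \<ge> 0" "M \<subseteq> {m. 0 < m \<and> real m \<le> x}"
  shows "finite M" "real (card M) \<le> x"
proof -
  have sub: "M \<subseteq> {1..nat \<lfloor>x\<rfloor>}" using assms by (auto simp: le_nat_floor)
  then show "finite M" by (rule finite_subset) auto
  have "card M \<le> nat \<lfloor>x\<rfloor>" using card_mono[OF _ sub] by simp
  then show "real (card M) \<le> x" using assms(1) by linarith
qed

text \<open>Within one class modulo \<open>L\<close> an element is determined by its quotient by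
  \<open>L\<close>, and the quotients lie between 0 and \<open>N / L\<close>.\<close>

lemma real_card_residue_class_le:
  fixes A :: "nat set" and L :: nat
  assumes "L > 0" "N \<ge> 0" "\<And>a. a \<in> A \<Longrightarrow> real a \<le> N"
    and "\<And>a b. a \<in> A \<Longrightarrow> b \<in> A \<Longrightarrow> [a = b] (mod L)"
  shows "finite A" "real (card A) \<le> 1 + N / real L"
proof -
  have inj: "inj_on (\<lambda>a. a div L) A"
    using assms(4) unfolding cong_def inj_on_def by (metis div_mult_mod_eq)
  have sub: "(\<lambda>a. a div L) ` A \<subseteq> {..nat \<lfloor>N / real L\<rfloor>}"
  proof safe
    fix a assume "a \<in> A"
    have "real (a div L) \<le> real a / real L" by (rule of_nat_div_le_of_nat)
    also have "\<dots> \<le> N / real L" using assms(1) assms(3)[OF \<open>a \<in> A\<close>] by (simp add: divide_right_mono)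
    finally show "a div L \<le> nat \<lfloor>N / real L\<rfloor>" by (simp add: le_nat_floor)
  qed
  show "finite A" using finite_subset[OF sub] inj finite_image_iff by blast
  have "card A \<le> Suc (nat \<lfloor>N / real L\<rfloor>)"
    using card_mono[OF _ sub] card_image[OF inj] by simp
  moreover have "N / real L \<ge> 0" using assms by simp
  ultimately show "real (card A) \<le> 1 + N / real L" by linarith
qed

text \<open>The least divisor that reaches \<open>x\<close> overshoots by at most one prime:
  removing a prime factor leaves a smaller divisor, which by minimality lies below
  \<open>x\<close>.\<close>

lemma exists_divisor_between:
  fixes m :: nat and x y :: real
  assumes "1 \<le> x" "x \<le> real m" "\<And>p. prime p \<Longrightarrow> p dvd m \<Longrightarrow> real p \<le> y" "1 \<le> y"
  obtains d where "d dvd m" "x \<le> real d" "real d \<le> x * y"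
proof -
  define d where "d = (LEAST d. d dvd m \<and> x \<le> real d)"
  have d: "d dvd m" "x \<le> real d"
    using LeastI[of "\<lambda>d. d dvd m \<and> x \<le> real d" m] assms unfolding d_def by auto
  have least: "d \<le> e" if "e dvd m" "x \<le> real e" for e
    unfolding d_def using that by (intro Least_le) auto
  show thesis
  proof (cases "d = 1")
    case True
    then show thesis using that[OF d] assms mult_mono[of 1 x 1 y] by simp
  next
    case False
    obtain p where p: "prime p" "p dvd d" using False prime_factor_nat by blast
    obtain e where e: "d = p * e" using p by blast
    have "e > 0" using d assms e by (auto intro: Nat.gr0I)
    then have "e < d" using prime_gt_1_nat[OF p(1)] e by simp
    then have "real e \<le> x" using least[of e] d e by fastforce
    moreover have "real p \<le> y" using assms p d by (meson dvd_trans)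
    ultimately have "real p * real e \<le> y * x" using assms by (intro mult_mono) auto
    then show thesis using that[OF d] e by (simp add: mult.commute)
  qed
qed

section \<open>Cototients of multiples, and solutions with a prescribed cofactor\<close>

abbreviation cototient_fibre :: "nat \<Rightarrow> nat set" where
  "cototient_fibre c \<equiv> {n. n > 0 \<and> cototient n = c}"

lemma totient_plus_cototient: "totient n + cototient n = n"
  by (simp add: cototient_def totient_le)

lemma cototient_pos: "n > 1 \<Longrightarrow> cototient n > 0"
  by (simp add: cototient_def totient_less)

text \<open>None of the \<open>y\<close> multiples of \<open>x\<close> up to \<open>x * y\<close> is
  coprime to \<open>x * y\<close>. Hence every proper divisor of a solution of
  \<open>cototient n = c\<close> is at most \<open>c\<close>.\<close>

lemma le_cototient_mult:
  assumes "x > 1"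
  shows "y \<le> cototient (x * y)"
proof -
  let ?M = "(*) x ` {1..y}"
  have card: "card ?M = y" using assms by (subst card_image) (auto simp: inj_on_def)
  have sub: "?M \<subseteq> {1..x * y}" using assms by auto
  have "totatives (x * y) \<subseteq> {1..x * y} - ?M"
    using assms by (auto simp: totatives_def)
  then have "card (totatives (x * y)) \<le> card ({1..x * y} - ?M)"
    by (intro card_mono) auto
  also have "\<dots> = x * y - y"
    using card_Diff_subset[OF _ sub] card by simp
  finally have "totient (x * y) \<le> x * y - y" by (simp add: totient_def)
  moreover have "y \<le> x * y" using assms by simp
  ultimately show ?thesis unfolding cototient_def by linarith
qed

text \<open>The totient of \<open>q * q\<close> is \<open>q * (q - 1)\<close> and divides the
  totient of \<open>n\<close>.\<close>

lemma prime_square_dvd_imp_dvd_cototient: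
  assumes "prime q" "q * q dvd n" "n > 0"
  shows "q dvd cototient n"
proof -
  have "q dvd totient (q * q)"
    using totient_power[of 2 q] by (simp add: power2_eq_square)
  then have "q dvd totient n" using totient_dvd[OF assms(2)] dvd_trans by blast
  moreover have "q dvd n" using assms by auto
  ultimately show ?thesis unfolding cototient_def by (rule dvd_diff_nat[rotated])
qed

lemma cototient_mult_prime:
  assumes "prime p" "\<not> p dvd m"
  shows "cototient (m * p) = cototient m * p + totient m"
proof -
  have "coprime m p" using assms by (metis coprime_commute prime_imp_coprime)
  then have "totient (m * p) = totient m * (p - 1)"
    using assms by (simp add: totient_mult_coprime totient_prime)
  then have "totient (m * p) + totient m = totient m * p"
    using assms prime_gt_0_nat[of p] by (cases p) simp_all
  moreover have "m * p = totient m * p + cototient m * p"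
    by (simp add: totient_plus_cototient flip: add_mult_distrib)
  ultimately show ?thesis using totient_plus_cototient[of "m * p"] by linarith
qed

lemma cototient_mult_prime_dvd:
  assumes "prime p" "p dvd m"
  shows "cototient (m * p) = cototient m * p"
proof -
  have "gcd m p = p" using assms by (simp add: gcd_proj2_if_dvd_nat)
  then have "totient (m * p) = totient m * p"
    using assms prime_gt_1_nat[of p] by (simp add: totient_mult totient_prime mult_ac)
  then show ?thesis by (simp add: cototient_def diff_mult_distrib)
qed

text \<open>For fixed \<open>m\<close>, the prime \<open>p\<close> solves one of two linear
  equations, according to whether it divides \<open>m\<close>. Both have slope
  \<open>cototient m\<close>, which is positive because \<open>m > 1\<close>.\<close>

lemma card_cototient_fibre_mult_prime:
  assumes "m > 1"
  shows "card {n \<in> cototient_fibre c. \<exists>p. prime p \<and> n = m * p} \<le> 2"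
    and "finite {n \<in> cototient_fibre c. \<exists>p. prime p \<and> n = m * p}"
proof -
  let ?B = "{m * ((c - totient m) div cototient m), m * (c div cototient m)}"
  have sub: "{n \<in> cototient_fibre c. \<exists>p. prime p \<and> n = m * p} \<subseteq> ?B"
  proof
    fix n assume "n \<in> {n \<in> cototient_fibre c. \<exists>p. prime p \<and> n = m * p}"
    then obtain p where p: "prime p" "n = m * p" "c = cototient (m * p)" by auto
    have "cototient m > 0" using cototient_pos[OF assms] .
    then show "n \<in> ?B"
      using p by (cases "p dvd m") (simp_all add: cototient_mult_prime cototient_mult_prime_dvd)
  qed
  show "card {n \<in> cototient_fibre c. \<exists>p. prime p \<and> n = m * p} \<le> 2"
    by (rule order_trans[OF card_mono[OF _ sub]]) (simp_all add: card_insert_if)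
  show "finite {n \<in> cototient_fibre c. \<exists>p. prime p \<and> n = m * p}"
    by (rule finite_subset[OF sub]) auto
qed

text \<open>With \<open>u = cototient m\<close> and \<open>v = totient m\<close>, the cototient of
  \<open>m * q * r\<close> is \<open>u * q * r + v * (q + r - 1)\<close>. Multiplying by
  \<open>u\<close> and completing the product leaves the constant
  \<open>v * v + u * v = v * m\<close>.\<close>

lemma cototient_two_primes_factorization:
  assumes "prime q" "prime r" "q \<noteq> r" "\<not> q dvd m" "\<not> r dvd m"
  shows "(cototient m * q + totient m) * (cototient m * r + totient m)
           = cototient m * cototient (m * q * r) + totient m * m"
proof -
  have r: "\<not> r dvd m * q"
    using assms by (metis prime_dvd_mult_iff primes_dvd_imp_eq)
  have "cototient (m * q * r) = cototient (m * q) * r + totient (m * q)"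
    using cototient_mult_prime[OF assms(2) r] .
  moreover have "cototient (m * q) = cototient m * q + totient m"
    using cototient_mult_prime assms by blast
  moreover have "m * q = totient (m * q) + cototient (m * q)"
    by (simp add: totient_plus_cototient)
  moreover have "m = totient m + cototient m"
    by (simp add: totient_plus_cototient)
  \<comment> \<open>The identities move to \<open>int\<close> because the totient of
    \<open>m * q\<close> enters as a difference.\<close>
  ultimately have *: "int (cototient (m * q * r)) = (int (cototient m) * int q + int (totient m)) * int r + int (totient (m * q))"
    "int (totient (m * q)) = int m * int q - int (cototient m) * int q - int (totient m)"
    "int m = int (totient m) + int (cototient m)"
    by (metis of_nat_add of_nat_mult, metis add_diff_cancel_right' diff_diff_eq of_nat_add of_nat_mult, metis of_nat_add)
  have "int ((cototient m * q + totient m) * (cototient m * r + totient m))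
           = int (cototient m * cototient (m * q * r) + totient m * m)"
    unfolding of_nat_add of_nat_mult *(1,2) unfolding *(3) by (simp add: algebra_simps)
  then show ?thesis by (simp only: of_nat_eq_iff)
qed

lemma card_cototient_fibre_mult_two_primes:
  fixes m c :: nat
  assumes "m > 1"
  defines "R \<equiv> {n \<in> cototient_fibre c. \<exists>q r. prime q \<and> prime r \<and> q \<noteq> r \<and>
    \<not> q dvd m \<and> \<not> r dvd m \<and> n = m * q * r}"
  shows "card R \<le> tau (cototient m * c + totient m * m)" "finite R"
proof -
  define D where "D = cototient m * c + totient m * m"
  \<comment> \<open>A divisor \<open>e\<close> of \<open>D\<close> returns \<open>q\<close>, and the
    complementary divisor \<open>D div e\<close> returns \<open>r\<close>. Divisors that come from
    no pair of primes only enlarge the image.\<close>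
  let ?f = "\<lambda>e. m * ((e - totient m) div cototient m) * ((D div e - totient m) div cototient m)"
  have pos: "cototient m > 0" "totient m > 0" using cototient_pos[OF assms(1)] assms(1) by auto
  have sub: "R \<subseteq> ?f ` {e. e dvd D}"
  proof
    fix n assume "n \<in> R"
    then obtain q r where qr: "prime q" "prime r" "q \<noteq> r" "\<not> q dvd m" "\<not> r dvd m"
      "n = m * q * r" "cototient n = c" by (auto simp: R_def)
    define e where "e = cototient m * q + totient m"
    have D: "D = e * (cototient m * r + totient m)"
      using cototient_two_primes_factorization[OF qr(1-5)] qr by (simp add: D_def e_def)
    have "e > 0" using pos by (simp add: e_def)
    then have "n = ?f e" using pos by (simp add: D) (simp add: e_def qr)
    moreover have "e dvd D" using D by simp
    ultimately show "n \<in> ?f ` {e. e dvd D}" by blast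
  qed
  have fin: "finite {e. e dvd D}" using pos assms(1) by (simp add: D_def)
  show "card R \<le> tau (cototient m * c + totient m * m)"
    using surj_card_le[OF fin sub] by (simp add: D_def)
  show "finite R" using finite_subset[OF sub] fin by blast
qed

section \<open>Residue classes modulo \<open>d\<close> and \<open>totient d\<close>\<close>

lemma card_residues_totient_le:
  fixes c d :: nat and N :: real
  assumes "d > 0" "N \<ge> 0"
  defines "g \<equiv> gcd d (totient d)"
  defines "A \<equiv> {n. c \<le> n \<and> real n \<le> N \<and> d dvd n \<and> totient d dvd n - c}"
  shows "real (card A) \<le> 1 + (if g dvd c then N * real (tau d) * real g / real d ^ 2 else 0)"
    and "finite A"
proof -
  define L where "L = lcm d (totient d)"
  have "L > 0" using assms by (simp add: L_def lcm_pos_nat)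
  have "[a = b] (mod L)" if "a \<in> A" "b \<in> A" for a b
  proof -
    have "[a = b] (mod d)" using that by (auto simp: A_def cong_def)
    moreover have "[a = c] (mod totient d)" "[b = c] (mod totient d)"
      using that by (auto simp: A_def cong_altdef_nat)
    then have "[a = b] (mod totient d)" using cong_sym cong_trans by blast
    ultimately show ?thesis unfolding L_def by (rule cong_cong_lcm_nat)
  qed
  then have "finite A" and card: "real (card A) \<le> 1 + N / real L"
    using real_card_residue_class_le[of L N A] \<open>L > 0\<close> assms(2) by (auto simp: A_def)
  show "finite A" by fact
  show "real (card A) \<le> 1 + (if g dvd c then N * real (tau d) * real g / real d ^ 2 else 0)"
  proof (cases "g dvd c")
    case True
    have "g > 0" using assms by (simp add: g_def)
    \<comment> \<open>A lower bound for \<open>L\<close>: since \<open>g * L = d * totient d\<close>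
      and \<open>d \<le> tau d * totient d\<close>, it follows that
      \<open>d ^ 2 \<le> tau d * g * L\<close>.\<close>
    have "d * d * L \<le> L * (d * (tau d * totient d))"
      using le_tau_mult_totient[OF assms(1)] by (simp add: mult_ac mult_le_mono)
    also have "\<dots> = L * (tau d * (g * L))"
      using prod_gcd_lcm_nat[of d "totient d"] by (simp add: g_def L_def mult_ac)
    finally have "d ^ 2 \<le> tau d * g * L"
      using \<open>L > 0\<close> by (simp add: power2_eq_square mult_ac)
    then have "real d ^ 2 \<le> real (tau d) * real g * real L"
      by (metis of_nat_le_iff of_nat_mult of_nat_power)
    then have "1 / real L \<le> real (tau d) * real g / real d ^ 2"
      using \<open>L > 0\<close> assms(1) by (simp add: field_simps)
    then have "N * (1 / real L) \<le> N * (real (tau d) * real g / real d ^ 2)"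
      using assms(2) by (rule mult_left_mono)
    then show ?thesis using card True by (simp add: mult.assoc)
  next
    case False
    have "n \<notin> A" for n
    proof
      assume "n \<in> A"
      then have "g dvd n" "g dvd n - c" "c \<le> n" unfolding A_def g_def by auto
      then have "g dvd c" by (metis dvd_diffD1)
      with False show False ..
    qed
    then have "A = {}" by blast
    then show ?thesis using False by simp
  qed
qed

text \<open>The pair \<open>(f d, d div f d)\<close> determines \<open>d\<close>, and the summand is
  the reciprocal of its second entry. So each divisor of \<open>c\<close> contributes at most one
  harmonic sum. The application takes \<open>f d\<close> to be the gcd of \<open>d\<close> and
  \<open>totient d\<close>.\<close>

lemma sum_divisor_ratio_le:
  fixes f :: "nat \<Rightarrow> nat"
  assumes "\<And>d. f d dvd d" "c > 0" "K > 0"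
  shows "(\<Sum>d | d \<in> {1..K} \<and> f d dvd c. real (f d) / real d) \<le> real (tau c) * (1 + ln (real K))"
proof -
  define S where "S = {d. d \<in> {1..K} \<and> f d dvd c}"
  let ?h = "\<lambda>d. (f d, d div f d)"
  have inj: "inj_on ?h S"
    using assms(1) by (intro inj_onI) (metis Pair_inject dvd_mult_div_cancel)
  have ratio: "real (f d) / real d = 1 / real (d div f d)" if "d \<in> S" for d
    using assms(1)[of d] that by (auto simp: S_def real_of_nat_div)
  have "(\<Sum>d\<in>S. real (f d) / real d) = (\<Sum>x\<in>?h ` S. 1 / real (snd x))"
    by (subst sum.reindex[OF inj]) (auto intro!: sum.cong simp: ratio)
  also have "\<dots> \<le> (\<Sum>x\<in>{e. e dvd c} \<times> {1..K}. 1 / real (snd x))"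
  proof (intro sum_mono2)
    show "?h ` S \<subseteq> {e. e dvd c} \<times> {1..K}"
    proof safe
      fix d assume d: "d \<in> S"
      have "f d > 0" using assms(2) d by (auto simp: S_def intro: Nat.gr0I)
      moreover have "f d \<le> d" using assms(1) d by (auto simp: S_def intro: dvd_imp_le)
      ultimately show "d div f d \<in> {1..K}"
        using d by (auto simp: S_def Suc_le_eq div_greater_zero_iff intro: order_trans[OF div_le_dividend])
    qed (auto simp: S_def)
  qed (use assms in auto)
  also have "\<dots> = real (tau c) * (\<Sum>k=1..K. 1 / real k)"
    by (simp add: sum.cartesian_product' )
  also have "\<dots> \<le> real (tau c) * (1 + ln (real K))"
    using sum_inverse_le_ln[OF assms(3)] by (intro mult_left_mono) auto
  finally show ?thesis by (simp add: S_def)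
qed

section \<open>The main term: products of two primes\<close>

abbreviation semiprimes :: "nat set" where
  "semiprimes \<equiv> {n. \<exists>p q. prime p \<and> prime q \<and> n = p * q}"

lemma sum_prod_eq_imp_eq:
  fixes p q p' q' :: nat
  assumes "p + q = p' + q'" "p * q = p' * q'" "p \<le> q" "p' \<le> q'"
  shows "p = p'"
proof -
  have s: "int q = int p' + int q' - int p" using assms(1) by linarith
  have "int p * int q = int p' * int q'" using assms(2) by (metis of_nat_mult)
  then have "(int p - int p') * (int p - int q') = 0"
    unfolding s by (simp add: algebra_simps)
  then have "p = p' \<or> p = q'" by auto
  \<comment> \<open>If \<open>p = q'\<close>, then \<open>q = p'\<close>, and the two orderings make
    all four numbers equal.\<close>
  then show ?thesis using assms by linarith
qed

lemma cototient_semiprime: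
  assumes "prime p" "prime q" "p \<noteq> q"
  shows "cototient (p * q) + 1 = p + q"
proof -
  have "\<not> q dvd p" using assms primes_dvd_imp_eq by metis
  then have "cototient (p * q) = cototient p * q + totient p"
    by (rule cototient_mult_prime[OF assms(2)])
  also have "\<dots> = q + (p - 1)"
    using assms(1) prime_gt_0_nat[of p] by (simp add: cototient_def totient_prime)
  finally show ?thesis using prime_gt_0_nat[OF assms(1)] by simp
qed

lemma cototient_prime_square: "prime p \<Longrightarrow> cototient (p * p) = p"
  by (simp add: cototient_mult_prime_dvd) (simp add: cototient_def totient_prime prime_gt_0_nat Suc_leI)

text \<open>The two counts differ only on the diagonal. The square of a prime is a solution only as
  \<open>c * c\<close>, while \<open>G\<close> counts one pair of equal primes if half of
  \<open>c + 1\<close> is prime. Each effect amounts to at most 1, and they have opposite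
  signs.\<close>

lemma card_semiprimes_cototient_fibre:
  assumes "c > 1"
  shows "\<bar>real (card (cototient_fibre c \<inter> semiprimes)) - real (G (c + 1))\<bar> \<le> 1"
proof -
  let ?S = "cototient_fibre c \<inter> semiprimes"
  define Gs where "Gs = {(p, q). prime p \<and> prime q \<and> p \<le> q \<and> p + q = c + 1}"
  define Gd where "Gd = {x \<in> Gs. fst x < snd x}"
  have "Gs \<subseteq> {..c + 1} \<times> {..c + 1}" by (auto simp: Gs_def)
  then have fin: "finite Gs" using finite_subset by blast
  have finS: "finite ?S" using finite_cototient_eq[OF assms] by blast
  have "?S \<subseteq> insert (c * c) ((\<lambda>(p, q). p * q) ` Gs)"
  proof
    fix n assume "n \<in> ?S"
    then obtain a b where ab: "prime a" "prime b" "n = a * b" "cototient n = c" by auto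
    obtain p q where pq: "prime p" "prime q" "n = p * q" "cototient n = c" "p \<le> q"
    proof (cases "a \<le> b")
      case True
      then show thesis using that ab by blast
    next
      case False
      then show thesis using that[of b a] ab by (simp add: mult.commute)
    qed
    show "n \<in> insert (c * c) ((\<lambda>(p, q). p * q) ` Gs)"
    proof (cases "p = q")
      case True
      then have "n = c * c" using pq cototient_prime_square[of p] by simp
      then show ?thesis by blast
    next
      case False
      then have "(p, q) \<in> Gs" using pq cototient_semiprime[of p q] by (auto simp: Gs_def)
      then have "(\<lambda>(p, q). p * q) (p, q) \<in> (\<lambda>(p, q). p * q) ` Gs" by (rule imageI)
      then show ?thesis using pq(3) by simp
    qed
  qed
  then have "card ?S \<le> card (insert (c * c) ((\<lambda>(p, q). p * q) ` Gs))"
    using fin by (intro card_mono) auto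
  also have "\<dots> \<le> Suc (card ((\<lambda>(p, q). p * q) ` Gs))"
    using fin by (simp add: card_insert_if)
  also have "\<dots> \<le> Suc (card Gs)" using card_image_le[OF fin] by simp
  finally have upper: "card ?S \<le> card Gs + 1" by simp
  have "inj_on (\<lambda>(p, q). p * q) Gd"
  proof (intro inj_onI, clarify)
    fix p q p' q' assume "(p, q) \<in> Gd" "(p', q') \<in> Gd" "p * q = p' * q'"
    moreover from this have "p = p'"
      by (intro sum_prod_eq_imp_eq[of p q p' q']) (auto simp: Gd_def Gs_def)
    ultimately show "p = p' \<and> q = q'" by (auto simp: Gd_def Gs_def)
  qed
  moreover have "(\<lambda>(p, q). p * q) ` Gd \<subseteq> ?S"
  proof
    fix n assume "n \<in> (\<lambda>(p, q). p * q) ` Gd"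
    then obtain p q where pq: "prime p" "prime q" "p < q" "p + q = c + 1" "n = p * q"
      by (auto simp: Gd_def Gs_def)
    then have "cototient n = c" using cototient_semiprime[of p q] by simp
    moreover have "n > 0" using pq prime_gt_0_nat by simp
    ultimately show "n \<in> ?S" using pq by blast
  qed
  ultimately have "card Gd \<le> card ?S" using finS by (rule card_inj_on_le)
  moreover have finD: "finite Gd" using fin by (simp add: Gd_def)
  have "Gs \<subseteq> insert ((c + 1) div 2, (c + 1) div 2) Gd"
    by (auto simp: Gd_def Gs_def)
  then have "card Gs \<le> card (insert ((c + 1) div 2, (c + 1) div 2) Gd)"
    using finD by (intro card_mono) simp_all
  then have "card Gs \<le> Suc (card Gd)"
    using finD by (simp add: card_insert_if split: if_splits)
  moreover have "G (c + 1) = card Gs" by (simp add: G_def Gs_def)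
  ultimately show ?thesis using upper by linarith
qed

section \<open>The remaining solutions and their three families\<close>

lemma obtain_largest_prime_factor:
  fixes n :: nat
  assumes "n > 1"
  obtains p m where "prime p" "n = m * p" "m > 0" "\<And>r. prime r \<Longrightarrow> r dvd n \<Longrightarrow> r \<le> p"
proof -
  have ne: "prime_factors n \<noteq> {}" using assms by (auto simp: prime_factorization_empty_iff)
  define p where "p = Max (prime_factors n)"
  have p: "p \<in> prime_factors n" using ne by (simp add: p_def)
  obtain m where m: "n = p * m" using p by (metis dvdE in_prime_factors_imp_dvd)
  show thesis
  proof (rule that[of p m])
    show "prime p" using p by auto
    show "n = m * p" using m by simp
    show "m > 0" using m assms by (auto intro: Nat.gr0I)
    show "r \<le> p" if "prime r" "r dvd n" for r
      using that assms by (auto simp: p_def prime_factors_dvd)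
  qed
qed

text \<open>The largest prime factor is removed twice. Both bounds come from
  \<open>le_cototient_mult\<close>: \<open>m * q\<close> is the cofactor of \<open>p\<close>, and a
  prime \<open>r\<close> dividing \<open>m\<close> has a cofactor at most \<open>c\<close> while
  \<open>r \<le> q\<close>.\<close>

lemma cototient_fibre_two_largest_primes:
  assumes "c > 1" "n \<in> cototient_fibre c - semiprimes"
  obtains m q p where "prime q" "prime p" "n = m * q * p" "m > 1" "q \<le> p"
    "\<And>r. prime r \<Longrightarrow> r dvd m \<Longrightarrow> r \<le> q" "m * q \<le> c" "n \<le> c * q"
proof -
  have n: "n > 1" "cototient n = c"
    using assms by (auto simp: cototient_def intro!: Suc_lessI)
  \<comment> \<open>A prime has cototient 1, which \<open>c > 1\<close> rules out.\<close>
  have "\<not> prime n" using n assms by (auto simp: cototient_def totient_prime)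
  obtain p M where p: "prime p" "n = M * p" "M > 0" "\<And>r. prime r \<Longrightarrow> r dvd n \<Longrightarrow> r \<le> p"
    using obtain_largest_prime_factor[OF n(1)] by blast
  have "M > 1" using p \<open>\<not> prime n\<close> by (cases "M = 1") auto
  then obtain q m where q: "prime q" "M = m * q" "m > 0" "\<And>r. prime r \<Longrightarrow> r dvd M \<Longrightarrow> r \<le> q"
    using obtain_largest_prime_factor by blast
  have "m \<noteq> 1"
  proof
    assume "m = 1"
    then have "n = q * p" using p q by simp
    then show False using assms(2) p(1) q(1) by blast
  qed
  then have m: "m > 1" using q by simp
  obtain r where r: "prime r" "r dvd m" using prime_factor_nat \<open>m \<noteq> 1\<close> by blast
  obtain k where k: "n = r * k" using r p q by (metis dvd_mult2 dvdE)
  have "k \<le> c" using le_cototient_mult[of r k] k n prime_gt_1_nat[OF r(1)] by simp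
  moreover have "r \<le> q" using q r by auto
  ultimately have "n \<le> c * q" unfolding k by (simp add: mult.commute mult_le_mono)
  moreover have "m * q \<le> c"
    using le_cototient_mult[of p M] p q n prime_gt_1_nat[OF p(1)] by (simp add: mult.commute)
  ultimately show thesis using p q m by (intro that[of q p m]) auto
qed

text \<open>The range of \<open>d\<close> is balanced: its lower end makes
  \<open>c powr (5/4)\<close> divided by \<open>d\<close> at most \<open>X\<close>, and an overshoot
  by one prime up to \<open>c powr (1/4)\<close> still stays within \<open>X\<close>.\<close>

lemma cototient_fibre_nonsemiprime_cover:
  fixes c :: nat
  assumes "c > 1"
  defines "X \<equiv> real c powr (3/4)"
  shows "cototient_fibre c - semiprimes \<subseteq>
    (\<Union>m\<in>{m. 1 < m \<and> real m \<le> X}. \<Union>q\<in>{q. q dvd c}.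
        {n \<in> cototient_fibre c. \<exists>p. prime p \<and> n = (m * q) * p})
    \<union> (\<Union>m\<in>{m. 1 < m \<and> real m \<le> X}. {n \<in> cototient_fibre c. \<exists>q r. prime q \<and> prime r \<and> q \<noteq> r \<and>
        \<not> q dvd m \<and> \<not> r dvd m \<and> n = m * q * r})
    \<union> (\<Union>d\<in>{d. real c powr (1/2) \<le> real d \<and> real d \<le> X}.
        {n. c \<le> n \<and> real n \<le> real c powr (5/4) \<and> d dvd n \<and> totient d dvd n - c})"
    (is "_ \<subseteq> ?A \<union> ?B \<union> ?D")
proof
  fix n assume n: "n \<in> cototient_fibre c - semiprimes"
  obtain m q p where mqp: "prime q" "prime p" "n = m * q * p" "m > 1" "q \<le> p"
    "\<And>r. prime r \<Longrightarrow> r dvd m \<Longrightarrow> r \<le> q" "m * q \<le> c" "n \<le> c * q"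
    using cototient_fibre_two_largest_primes[OF assms(1) n] by blast
  show "n \<in> ?A \<union> ?B \<union> ?D"
  proof (cases "real m \<le> X")
    case True
    show ?thesis
    proof (cases "q dvd c")
      case True
      then have "n \<in> ?A" using n mqp \<open>real m \<le> X\<close> by blast
      then show ?thesis by blast
    next
      case False
      \<comment> \<open>With no square of \<open>q\<close> in \<open>n\<close>, the prime
        \<open>q\<close> differs from \<open>p\<close> and does not divide \<open>m\<close>; then
        \<open>p > q\<close> exceeds every prime factor of \<open>m\<close>.\<close>
      have "\<not> q * q dvd n"
        using prime_square_dvd_imp_dvd_cototient[OF mqp(1)] False n by auto
      then have "q \<noteq> p" "\<not> q dvd m" using mqp(3) by auto
      moreover have "\<not> p dvd m" using mqp(6)[OF mqp(2)] mqp(5) \<open>q \<noteq> p\<close> by linarith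
      ultimately have "n \<in> ?B" using n mqp \<open>real m \<le> X\<close> by blast
      then show ?thesis by blast
    qed
  next
    case False
    have "real m * real q \<le> real c" using mqp(7) by (metis of_nat_le_iff of_nat_mult)
    moreover have "X * real q \<le> real m * real q" using False by (intro mult_right_mono) auto
    moreover have "real c = X * real c powr (1/4)"
      using assms(1) by (simp add: X_def flip: powr_add)
    ultimately have "X * real q \<le> X * real c powr (1/4)" by linarith
    then have q: "real q \<le> real c powr (1/4)"
      using assms(1) by (simp add: X_def)
    have "real c powr (1/2) \<le> X" using assms(1) by (simp add: X_def powr_mono)
    then have "real c powr (1/2) \<le> real m" using False by simp
    moreover have "1 \<le> real c powr (1/2)" "1 \<le> real c powr (1/4)"
      using assms(1) by (simp_all add: ge_one_powr_ge_zero)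
    moreover have "real r \<le> real c powr (1/4)" if "prime r" "r dvd m" for r
      using mqp(6)[OF that] q by linarith
    ultimately obtain d where d: "d dvd m" "real c powr (1/2) \<le> real d"
      "real d \<le> real c powr (1/2) * real c powr (1/4)"
      using exists_divisor_between[of "real c powr (1/2)" m "real c powr (1/4)"] by blast
    then have "real d \<le> X" by (simp add: X_def flip: powr_add)
    have "real n \<le> real c * real q" using mqp(8) by (metis of_nat_le_iff of_nat_mult)
    also have "\<dots> \<le> real c powr 1 * real c powr (1/4)" using q by (intro mult_mono) auto
    also have "\<dots> = real c powr (5/4)" by (subst powr_add[symmetric]) simp
    finally have "real n \<le> real c powr (5/4)" .
    moreover have "d dvd n" using d mqp by simp
    moreover have "totient n + c = n" using totient_plus_cototient[of n] n by simp
    then have "c \<le> n" "n - c = totient n" by linarith+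
    ultimately have "n \<in> ?D" using d \<open>real d \<le> X\<close> totient_dvd[of d n] by auto
    then show ?thesis by blast
  qed
qed

section \<open>Bounding the three families\<close>

lemma card_UN_le_mult:
  assumes "finite I" "real (card I) \<le> x" "\<And>i. i \<in> I \<Longrightarrow> real (card (S i)) \<le> b" "b \<ge> 0"
  shows "real (card (\<Union>i\<in>I. S i)) \<le> x * b"
proof -
  have "real (card (\<Union>i\<in>I. S i)) \<le> (\<Sum>i\<in>I. real (card (S i)))"
    unfolding of_nat_sum[symmetric] of_nat_le_iff by (rule card_UN_le[OF assms(1)])
  also have "\<dots> \<le> real (card I) * b"
    by (rule sum_bounded_above) (rule assms(3))
  also have "\<dots> \<le> x * b" using assms by (intro mult_right_mono) auto
  finally show ?thesis .
qed

text \<open>Each family has size at most a constant times \<open>X * Y ^ 3\<close>. In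
  \<open>B\<close> the cube comes from counting the divisors of a number up to \<open>c ^ 3\<close>;
  in \<open>D\<close> one \<open>Y\<close> comes from \<open>tau d\<close>, one from
  \<open>tau c\<close> and one from a logarithm.\<close>

lemma card_cototient_fibre_nonsemiprime_le:
  fixes \<delta> C :: real and c :: nat
  assumes "c > 1" "\<delta> > 0"
    and C: "C \<ge> 1" "\<And>n. n > 0 \<Longrightarrow> real (tau n) \<le> C * real n powr \<delta>"
  shows "real (card (cototient_fibre c - semiprimes))
           \<le> (3 * C + 1 + C ^ 2 * (1 + 1 / \<delta>)) * real c powr (3/4 + 3 * \<delta>)"
proof -
  define X where "X = real c powr (3/4)"
  define Y where "Y = real c powr \<delta>"
  define N where "N = real c powr (5/4)"
  define Ms where "Ms = {m. 1 < m \<and> real m \<le> X}"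
  define Ds where "Ds = {d. real c powr (1/2) \<le> real d \<and> real d \<le> X}"
  define A where "A = (\<Union>m\<in>Ms. \<Union>q\<in>{q. q dvd c}.
        {n \<in> cototient_fibre c. \<exists>p. prime p \<and> n = (m * q) * p})"
  define B where "B = (\<Union>m\<in>Ms. {n \<in> cototient_fibre c. \<exists>q r. prime q \<and> prime r \<and> q \<noteq> r \<and>
        \<not> q dvd m \<and> \<not> r dvd m \<and> n = m * q * r})"
  define Rs where "Rs = (\<lambda>d. {n. c \<le> n \<and> real n \<le> N \<and> d dvd n \<and> totient d dvd n - c})"
  define D where "D = (\<Union>d\<in>Ds. Rs d)"
  have c: "real c \<ge> 1" "real c \<ge> 2" using assms(1) by auto
  have pos: "X > 0" "Y \<ge> 1" "N > 0"
    using assms c by (auto simp: X_def Y_def N_def ge_one_powr_ge_zero)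
  have "X \<le> real c powr 1" unfolding X_def using c by (intro powr_mono) auto
  then have Xc: "X \<le> real c" using c by simp
  have Y_powr: "real c powr (3 * \<delta>) = Y ^ 3"
    using assms(1) by (simp add: Y_def powr_power)
  have Y_le: "Y \<le> Y ^ 3" "1 \<le> Y ^ 3"
    using pos power_increasing[of 1 3 Y] by auto
  have tau_c: "real (tau c) \<le> C * Y" using C(2)[of c] assms(1) by (simp add: Y_def)
  have Ms: "finite Ms" "real (card Ms) \<le> X"
    using real_card_positive_le[of X Ms] pos unfolding Ms_def by force+
  have cpow: "real c powr (1/2) > 0" using assms(1) by simp
  then have Ds_pos: "d > 0" if "d \<in> Ds" for d
    using that by (auto simp: Ds_def intro: Nat.gr0I)
  then have Ds: "finite Ds" "real (card Ds) \<le> X"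
    using real_card_positive_le[of X Ds] pos Ds_pos unfolding Ds_def by force+
  have fin_div: "finite {q. q dvd c}" using assms(1) by simp

  have cardA: "real (card A) \<le> X * ((C * Y) * 2)"
    unfolding A_def
  proof (intro card_UN_le_mult Ms fin_div tau_c)
    fix m q assume "m \<in> Ms" "q \<in> {q. q dvd c}"
    then have "m > 1" "q > 0" using assms(1) by (auto simp: Ms_def intro: Nat.gr0I)
    then have "m * q > 1" by (metis less_le_trans mult_le_mono2 nat_mult_1_right Suc_leI One_nat_def)
    then show "real (card {n \<in> cototient_fibre c. \<exists>p. prime p \<and> n = (m * q) * p}) \<le> 2"
      using card_cototient_fibre_mult_prime(1)[of "m * q" c] by linarith
  qed (use C pos in auto)

  have cardB: "real (card B) \<le> X * (C * Y ^ 3)"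
    unfolding B_def
  proof (intro card_UN_le_mult Ms)
    fix m assume "m \<in> Ms"
    then have m: "m > 1" "m \<le> c" using Xc by (auto simp: Ms_def)
    let ?k = "cototient m * c + totient m * m"
    have "?k > 0" using m by auto
    have "?k \<le> c * c + c * c"
      using m totient_le[of m] by (intro add_mono mult_le_mono) (auto simp: cototient_def)
    also have "\<dots> = 2 * c ^ 2" by (simp add: power2_eq_square)
    \<comment> \<open>Here \<open>c \<ge> 2\<close> absorbs the factor 2.\<close>
    also have "\<dots> \<le> c ^ 3"
      using assms(1) by (simp add: power3_eq_cube power2_eq_square)
    finally have "real ?k \<le> real c ^ 3" by (metis of_nat_le_iff of_nat_power)
    then have "real ?k powr \<delta> \<le> (real c ^ 3) powr \<delta>"
      using assms(2) by (intro powr_mono2) auto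
    also have "\<dots> = Y ^ 3"
      by (simp add: Y_def power3_eq_cube powr_mult)
    finally have "C * real ?k powr \<delta> \<le> C * Y ^ 3" using C by (intro mult_left_mono) auto
    then have "real (tau ?k) \<le> C * Y ^ 3" using C(2)[OF \<open>?k > 0\<close>] by linarith
    then show "real (card {n \<in> cototient_fibre c. \<exists>q r. prime q \<and> prime r \<and> q \<noteq> r \<and>
        \<not> q dvd m \<and> \<not> r dvd m \<and> n = m * q * r}) \<le> C * Y ^ 3"
      using card_cototient_fibre_mult_two_primes(1)[OF m(1), of c] by linarith
  qed (use C pos in auto)

  define g where "g = (\<lambda>d. gcd d (totient d))"
  \<comment> \<open>Of the two factors \<open>1 / d\<close>, one turns \<open>N\<close> into at most
    \<open>X\<close>, because \<open>d\<close> is at least the square root of \<open>c\<close>; the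
    other stays with \<open>g d\<close> for the summation over \<open>d\<close>.\<close>
  have R: "real (card (Rs d)) \<le> 1 + (if g d dvd c then X * (C * Y) * (real (g d) / real d) else 0)"
    if "d \<in> Ds" for d
  proof -
    have d: "d > 0" "real c powr (1/2) \<le> real d" "real d \<le> real c"
      using that Ds_pos Xc by (auto simp: Ds_def)
    have "real d powr \<delta> \<le> Y" unfolding Y_def using d assms(2) by (intro powr_mono2) auto
    then have "C * real d powr \<delta> \<le> C * Y" using C by (intro mult_left_mono) auto
    then have tau_d: "real (tau d) \<le> C * Y" using C(2)[OF d(1)] by linarith
    have "N = X * real c powr (1/2)" by (simp add: N_def X_def flip: powr_add)
    also have "\<dots> \<le> X * real d" using d pos by (intro mult_left_mono) auto
    finally have "N / real d \<le> X" using d by (simp add: field_simps)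
    then have "(N / real d) * real (tau d) * (real (g d) / real d) \<le> X * (C * Y) * (real (g d) / real d)"
      using tau_d pos C by (intro mult_right_mono mult_mono) auto
    moreover have "N * real (tau d) * real (g d) / real d ^ 2
        = (N / real d) * real (tau d) * (real (g d) / real d)"
      by (simp add: power2_eq_square)
    ultimately show ?thesis
      using card_residues_totient_le(1)[OF d(1), of N c] pos
      unfolding Rs_def g_def by (auto split: if_splits)
  qed
  \<comment> \<open>The logarithm of \<open>c\<close> is at most \<open>Y / \<delta>\<close>, and
    the summand 1 is at most \<open>Y\<close>.\<close>
  have log: "1 + ln (real c) \<le> (1 + 1 / \<delta>) * Y"
    using ln_powr_bound[OF c(1) assms(2)] pos by (simp add: Y_def algebra_simps)
  have "(\<Sum>d\<in>Ds. if g d dvd c then real (g d) / real d else 0)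
      = (\<Sum>d | d \<in> Ds \<and> g d dvd c. real (g d) / real d)"
    using Ds(1) by (simp add: sum.inter_filter)
  also have "\<dots> \<le> (\<Sum>d | d \<in> {1..c} \<and> g d dvd c. real (g d) / real d)"
  proof (rule sum_mono2)
    have "d \<in> {1..c}" if "d \<in> Ds" for d
    proof -
      have "real d \<le> real c" using that Xc by (auto simp: Ds_def)
      then show ?thesis using Ds_pos[OF that] by simp
    qed
    then show "{d. d \<in> Ds \<and> g d dvd c} \<subseteq> {d. d \<in> {1..c} \<and> g d dvd c}" by blast
  qed auto
  also have "\<dots> \<le> real (tau c) * (1 + ln (real c))"
    using assms(1) by (intro sum_divisor_ratio_le) (auto simp: g_def)
  also have "\<dots> \<le> (C * Y) * ((1 + 1 / \<delta>) * Y)"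
    using tau_c log pos C c by (intro mult_mono) auto
  finally have ratio: "(\<Sum>d\<in>Ds. if g d dvd c then real (g d) / real d else 0)
      \<le> (C * Y) * ((1 + 1 / \<delta>) * Y)" .
  have "real (card D) \<le> (\<Sum>d\<in>Ds. real (card (Rs d)))"
    unfolding D_def of_nat_sum[symmetric] of_nat_le_iff by (rule card_UN_le[OF Ds(1)])
  also have "\<dots> \<le> (\<Sum>d\<in>Ds. 1 + X * (C * Y) * (if g d dvd c then real (g d) / real d else 0))"
  proof (rule sum_mono)
    fix d assume "d \<in> Ds"
    from R[OF this] show "real (card (Rs d))
        \<le> 1 + X * (C * Y) * (if g d dvd c then real (g d) / real d else 0)"
      by (cases "g d dvd c") simp_all
  qed
  also have "\<dots> = real (card Ds) + X * (C * Y) * (\<Sum>d\<in>Ds. if g d dvd c then real (g d) / real d else 0)"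
    by (simp add: sum.distrib flip: sum_distrib_left)
  also have "\<dots> \<le> X + X * (C * Y) * ((C * Y) * ((1 + 1 / \<delta>) * Y))"
    using Ds ratio pos C by (intro add_mono mult_left_mono) auto
  finally have cardD: "real (card D) \<le> X + X * (C ^ 2 * (1 + 1 / \<delta>) * Y ^ 3)"
    by (simp add: power2_eq_square power3_eq_cube mult_ac)

  have "finite A" unfolding A_def using Ms fin_div assms(1)
    by (auto intro!: finite_subset[OF _ finite_cototient_eq[OF assms(1)]])
  moreover have "finite B" unfolding B_def using Ms
    by (auto intro!: finite_subset[OF _ finite_cototient_eq[OF assms(1)]])
  moreover have "finite D" unfolding D_def Rs_def using Ds Ds_pos pos
    by (auto intro!: card_residues_totient_le(2))
  moreover have "cototient_fibre c - semiprimes \<subseteq> A \<union> B \<union> D"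
    unfolding A_def B_def D_def Rs_def Ms_def Ds_def N_def X_def
    by (rule cototient_fibre_nonsemiprime_cover[OF assms(1)])
  ultimately have "card (cototient_fibre c - semiprimes) \<le> card (A \<union> B \<union> D)"
    by (intro card_mono) auto
  also have "\<dots> \<le> card A + card B + card D"
    using card_Un_le[of "A \<union> B" D] card_Un_le[of A B] by linarith
  finally have "real (card (cototient_fibre c - semiprimes))
      \<le> real (card A) + real (card B) + real (card D)" by linarith
  also have "\<dots> \<le> X * ((C * Y) * 2) + X * (C * Y ^ 3) + (X + X * (C ^ 2 * (1 + 1 / \<delta>) * Y ^ 3))"
    by (intro add_mono cardA cardB cardD)
  also have "\<dots> = X * (2 * C * Y + C * Y ^ 3 + 1 + C ^ 2 * (1 + 1 / \<delta>) * Y ^ 3)"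
    by (simp add: algebra_simps)
  also have "\<dots> \<le> X * (2 * C * Y ^ 3 + C * Y ^ 3 + Y ^ 3 + C ^ 2 * (1 + 1 / \<delta>) * Y ^ 3)"
    using Y_le pos C assms(2) by (intro mult_left_mono add_mono) auto
  also have "\<dots> = (3 * C + 1 + C ^ 2 * (1 + 1 / \<delta>)) * (X * Y ^ 3)"
    by (simp add: algebra_simps)
  also have "X * Y ^ 3 = real c powr (3/4 + 3 * \<delta>)"
    by (simp add: X_def powr_add flip: Y_powr)
  finally show ?thesis .
qed

section \<open>From an arbitrarily small loss in the exponent to \<open>o(1)\<close>\<close>

lemma card_cototient_fibre_approx:
  fixes \<eta> :: real
  assumes "\<eta> > 0"
  obtains K :: real where "\<And>c. c > 1 \<Longrightarrow>
    \<bar>real (card (cototient_fibre c)) - real (G (c + 1))\<bar> \<le> K * real c powr (3/4 + \<eta>)"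
proof -
  define \<delta> where "\<delta> = \<eta> / 3"
  have \<delta>: "\<delta> > 0" "3 * \<delta> = \<eta>" using assms by (simp_all add: \<delta>_def)
  obtain C :: real where C: "C \<ge> 1" "\<And>n. n > 0 \<Longrightarrow> real (tau n) \<le> C * real n powr \<delta>"
    using tau_le_mult_powr[OF \<delta>(1)] by blast
  define K where "K = 3 * C + 1 + C ^ 2 * (1 + 1 / \<delta>)"
  show thesis
  \<comment> \<open>The additional 1 pays for the bounded discrepancy between semiprimes and
    \<open>G\<close>.\<close>
  proof (rule that[of "K + 1"])
    fix c :: nat assume c: "c > 1"
    have "card (cototient_fibre c)
        = card (cototient_fibre c \<inter> semiprimes) + card (cototient_fibre c - semiprimes)"
      using finite_cototient_eq[OF c] by (rule card_Int_Diff)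
    moreover have "real (card (cototient_fibre c - semiprimes)) \<le> K * real c powr (3/4 + \<eta>)"
      using card_cototient_fibre_nonsemiprime_le[OF c \<delta>(1) C] by (simp add: K_def \<delta>(2))
    moreover have "1 \<le> real c powr (3/4 + \<eta>)"
      using c assms by (intro ge_one_powr_ge_zero) auto
    ultimately show "\<bar>real (card (cototient_fibre c)) - real (G (c + 1))\<bar>
        \<le> (K + 1) * real c powr (3/4 + \<eta>)"
      using card_semiprimes_cototient_fibre[OF c] by (simp add: algebra_simps)
  qed
qed

text \<open>The function \<open>\<epsilon>\<close> is the excess over \<open>a\<close> of the
  exponent that \<open>E n\<close> actually requires, so the second claim holds with constant 1.
  Half of each \<open>\<eta>\<close> is spent on absorbing \<open>K\<close> for large
  \<open>n\<close>.\<close>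

lemma powr_bounds_imp_powr_little_o:
  fixes E :: "nat \<Rightarrow> real" and a :: real
  assumes "\<And>\<eta>. \<eta> > 0 \<Longrightarrow> \<exists>K. \<forall>n>1. \<bar>E n\<bar> \<le> K * real n powr (a + \<eta>)"
  obtains \<epsilon> :: "nat \<Rightarrow> real" where "\<epsilon> \<in> o(\<lambda>_. 1)" "E \<in> O(\<lambda>n. real n powr (a + \<epsilon> n))"
proof -
  \<comment> \<open>The maximum with 0 keeps \<open>\<epsilon>\<close> from going negative where
    \<open>E n\<close> is small; the case \<open>E n = 0\<close> is separate because the logarithm
    says nothing there.\<close>
  define \<epsilon> where "\<epsilon> = (\<lambda>n. if E n = 0 then 0 else max 0 (ln \<bar>E n\<bar> / ln (real n) - a))"
  have "\<forall>\<^sub>F n in sequentially. norm (\<epsilon> n) \<le> \<eta> * norm (1::real)" if \<eta>: "\<eta> > 0" for \<eta>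
  proof -
    obtain K where K: "\<And>n. n > 1 \<Longrightarrow> \<bar>E n\<bar> \<le> K * real n powr (a + \<eta> / 2)"
      using assms[of "\<eta> / 2"] \<eta> by auto
    \<comment> \<open>From here on \<open>n powr (\<eta> / 2)\<close> exceeds or equals
      \<open>K\<close>. The maximum with 1 gives a positive base even if \<open>K\<close> is not
      positive.\<close>
    define n0 where "n0 = nat \<lceil>max 1 K powr (2 / \<eta>)\<rceil>"
    have "K \<le> real n powr (\<eta> / 2)" if "n \<ge> n0" for n
    proof -
      have "max 1 K powr (2 / \<eta>) \<le> real n" using that by (simp add: n0_def)
      then have "(max 1 K powr (2 / \<eta>)) powr (\<eta> / 2) \<le> real n powr (\<eta> / 2)"
        using \<eta> by (intro powr_mono2) auto
      then show ?thesis using \<eta> by (simp add: powr_powr)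
    qed
    then have "\<forall>\<^sub>F n in sequentially. K \<le> real n powr (\<eta> / 2)"
      by (rule eventually_sequentiallyI)
    then show ?thesis
      using eventually_gt_at_top[of 1]
    proof eventually_elim
      case (elim n)
      show ?case
      proof (cases "E n = 0")
        case False
        have "K * real n powr (a + \<eta> / 2) \<le> real n powr (\<eta> / 2) * real n powr (a + \<eta> / 2)"
          using elim by (intro mult_right_mono) auto
        then have "\<bar>E n\<bar> \<le> real n powr (a + \<eta>)"
          using K[of n] elim by (simp add: algebra_simps flip: powr_add)
        then have "ln \<bar>E n\<bar> \<le> ln (real n powr (a + \<eta>))"
          using False elim by (subst ln_le_cancel_iff) auto
        also have "\<dots> = (a + \<eta>) * ln (real n)" using elim by (simp add: ln_powr)
        finally have "ln \<bar>E n\<bar> / ln (real n) \<le> a + \<eta>" using elim by (simp add: pos_divide_le_eq)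
        then show ?thesis using \<eta> by (simp add: \<epsilon>_def)
      qed (use \<eta> in \<open>simp add: \<epsilon>_def\<close>)
    qed
  qed
  then have "\<epsilon> \<in> o(\<lambda>_. 1)" by (rule landau_o.smallI)
  moreover have "\<bar>E n\<bar> \<le> real n powr (a + \<epsilon> n)" if "n > 1" for n
  proof (cases "E n = 0")
    case False
    have "\<bar>E n\<bar> = real n powr (ln \<bar>E n\<bar> / ln (real n))"
      using False that by (simp add: powr_def)
    also have "\<dots> \<le> real n powr (a + \<epsilon> n)"
      using False that by (intro powr_mono) (auto simp: \<epsilon>_def)
    finally show ?thesis .
  qed simp
  then have "E \<in> O(\<lambda>n. real n powr (a + \<epsilon> n))"
    by (intro bigoI[of _ 1] eventually_mono[OF eventually_gt_at_top[of 1]]) simp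
  ultimately show thesis by (rule that)
qed

theorem theorem1p1:
  "\<exists>(\<epsilon> :: nat \<Rightarrow> real) (E :: nat \<Rightarrow> real).
     \<epsilon> \<in> o(\<lambda>_. 1) \<and>
     E \<in> O(\<lambda>c. real c powr (0.75 + \<epsilon> c)) \<and>
     (\<forall>c>1. real (card {n. n > 0 \<and> cototient n = c}) = real (G (c + 1)) + E c)"
proof -
  define E where "E = (\<lambda>c. real (card (cototient_fibre c)) - real (G (c + 1)))"
  have "\<exists>K. \<forall>c>1. \<bar>E c\<bar> \<le> K * real c powr (0.75 + \<eta>)" if "\<eta> > 0" for \<eta>
    using card_cototient_fibre_approx[OF that] unfolding E_def by (simp, metis)
  then obtain \<epsilon> where "\<epsilon> \<in> o(\<lambda>_. 1)" "E \<in> O(\<lambda>c. real c powr (0.75 + \<epsilon> c))"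
    using powr_bounds_imp_powr_little_o by blast
  then show ?thesis unfolding E_def by (intro exI[of _ \<epsilon>] exI[of _ E]) (auto simp: E_def)
qed

end
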